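(* The set of permutations obtained as products of transpositions associated to a partial filling of the shifted staircase shape $\Delta_n$ is exactly $\mathcal{L}_n$, the set of left-unimodal permutations in $\mathcal{S}_n$.
   Context: A permutation $\pi\in\mathcal{S}_n$ is left-unimodal if for every $1\le j\le n$ the set $\{\pi(1),\dots,\pi(j)\}$ is an interval in $\mathbb{Z}$, i.e. of the form $\{a,a+1,\dots,b\}$; $\mathcal{L}_n$ is the set of left-unimodal permutations in $\mathcal{S}_n$. The shifted staircase shape $\Delta_n$ is the set of boxes $(i,j)$ with $1\le i<j\le n$, where $i$ is the row label (rows labeled $1,\dots,n-1$ from top to bottom) and $j$ is the column label (columns labeled $2,\dots,n$ from left to right). Take a filling of $\Delta_n$ with the numbers $1,\dots,n(n-1)/2$, each used once, with entries increasing along rows (left to right) and columns (top to bottom), and erase the numbers greater than $k$ for some $0\le k\le n(n-1)/2$; the result is called a partial filling of $\Delta_n$. For each remaining entry $1\le r\le k$ lying in row $i$ and column $j$, let $t_r$ be the transposition $(i,j)$. The permutation associated to the partial filling is $\pi=t_1t_2\cdots t_k$, where the product is computed left to right: $\pi(x)$ is obtained by applying $t_1$ to $x$ first, then $t_2$, and so on, finally $t_k$ (so for example $(1,2)(1,3)$ is the permutation $231$ in one-line notation, and $(1,2)(1,3)(1,4)(2,3)(2,4)(1,5)(3,4)(1,6)(2,5)(2,6)=4356217$). For $k=0$ the permutation is the identity. *)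

theory Defs
  imports Main "HOL-Combinatorics.Permutations"
begin

definition left_unimodal :: "nat \<Rightarrow> (nat \<Rightarrow> nat) \<Rightarrow> bool" where
  "left_unimodal n p \<longleftrightarrow>
     p permutes {1..n} \<and> (\<forall>j. 1 \<le> j \<and> j \<le> n \<longrightarrow> (\<exists>a b. p ` {1..j} = {a..b}))"

definition left_unimodal_perms :: "nat \<Rightarrow> (nat \<Rightarrow> nat) set" where
  "left_unimodal_perms n = {p. left_unimodal n p}"

definition staircase :: "nat \<Rightarrow> (nat \<times> nat) set" where
  "staircase n = {(i, j). 1 \<le> i \<and> i < j \<and> j \<le> n}"

text \<open>A filling is a function on boxes; its values outside the staircase are irrelevant.\<close>

definition is_filling :: "nat \<Rightarrow> (nat \<times> nat \<Rightarrow> nat) \<Rightarrow> bool" where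
  "is_filling n T \<longleftrightarrow>
     bij_betw T (staircase n) {1..n * (n - 1) div 2} \<and>
     (\<forall>i j j'. (i, j) \<in> staircase n \<and> (i, j') \<in> staircase n \<and> j < j' \<longrightarrow> T (i, j) < T (i, j')) \<and>
     (\<forall>i i' j. (i, j) \<in> staircase n \<and> (i', j) \<in> staircase n \<and> i < i' \<longrightarrow> T (i, j) < T (i', j))"

definition erase_above :: "nat \<Rightarrow> nat \<Rightarrow> (nat \<times> nat \<Rightarrow> nat) \<Rightarrow> (nat \<times> nat \<Rightarrow> nat option)" where
  "erase_above n k T = (\<lambda>b. if b \<in> staircase n \<and> T b \<le> k then Some (T b) else None)"

definition is_partial_filling :: "nat \<Rightarrow> (nat \<times> nat \<Rightarrow> nat option) \<Rightarrow> bool" where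
  "is_partial_filling n P \<longleftrightarrow>
     (\<exists>T k. is_filling n T \<and> k \<le> n * (n - 1) div 2 \<and> P = erase_above n k T)"

definition box_of :: "(nat \<times> nat \<Rightarrow> nat option) \<Rightarrow> nat \<Rightarrow> nat \<times> nat" where
  "box_of P r = (THE b. P b = Some r)"

definition entry_transposition :: "(nat \<times> nat \<Rightarrow> nat option) \<Rightarrow> nat \<Rightarrow> nat \<Rightarrow> nat" where
  "entry_transposition P r = (case box_of P r of (i, j) \<Rightarrow> transpose i j)"

text \<open>The remaining entries are \<open>1, \<dots>, k\<close> with \<open>k = card (dom P)\<close>, and the fold computes
  \<open>t\<^sub>k \<circ> \<dots> \<circ> t\<^sub>2 \<circ> t\<^sub>1\<close>, so \<open>t\<^sub>1\<close> is applied first.\<close>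

definition associated_perm :: "(nat \<times> nat \<Rightarrow> nat option) \<Rightarrow> nat \<Rightarrow> nat" where
  "associated_perm P =
     fold (\<lambda>r p. entry_transposition P r \<circ> p) [1..<Suc (card (dom P))] id"

lemma card_dom_erase_above:
  assumes "is_filling n T" and k: "k \<le> n * (n - 1) div 2"
  shows "card (dom (erase_above n k T)) = k"
proof -
  have b: "bij_betw T (staircase n) {1..n * (n - 1) div 2}"
    using assms by (simp add: is_filling_def)
  let ?D = "{b \<in> staircase n. T b \<le> k}"
  have d: "dom (erase_above n k T) = ?D"
    by (auto simp: erase_above_def dom_def split: if_splits)
  have "inj_on T ?D"
    using b by (auto simp: bij_betw_def inj_on_def)
  moreover have "T ` ?D = {m \<in> T ` staircase n. m \<le> k}"
    by blast
  moreover have "{m \<in> T ` staircase n. m \<le> k} = {1..k}"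
    using b k by (auto simp: bij_betw_def)
  ultimately have "card ?D = card {1..k}"
    by (metis card_image)
  then show ?thesis
    using d by simp
qed

lemma box_of_erase_above:
  assumes "is_filling n T" and "b \<in> staircase n" and "T b \<le> k"
  shows "box_of (erase_above n k T) (T b) = b"
  using assms
  by (auto simp: box_of_def erase_above_def is_filling_def bij_betw_def inj_on_def
           intro!: the_equality split: if_splits)

end

theory Submission imports Defs begin

text \<open>The shape left by a partial filling has \<open>g d\<close> boxes on the diagonal \<open>j - i = d\<close>, where
  \<open>g (d + 1) \<le> g d \<le> g (d + 1) + 1\<close>. Adding a box on diagonal \<open>p\<close> changes \<open>g p\<close> only, and its
  transposition exchanges exactly the values at the positions \<open>p\<close> and \<open>p + 1\<close>. Inductively, the
  permutation maps \<open>{1..j}\<close> onto \<open>{g j + 1..g j + j}\<close>, so it is left-unimodal and is determined by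
  \<open>g\<close>. Conversely the minima of these intervals recover \<open>g\<close> from a left-unimodal permutation, and
  the corresponding order ideal is an initial segment of some linear extension of the staircase.\<close>

section \<open>Diagonal profiles, their shapes and their permutations\<close>

text \<open>The inequalities encode closure under left and upper neighbours within the staircase,
  which lie one diagonal nearer and one diagonal farther out. Diagonals from \<open>n\<close> on
  miss the staircase; \<open>g 0 = 0\<close> is a default that makes \<open>g\<close>
  unique.\<close>

definition diag_profile :: "nat \<Rightarrow> (nat \<Rightarrow> nat) \<Rightarrow> bool" where
  "diag_profile n g \<longleftrightarrow> g 0 = 0 \<and> (\<forall>d\<ge>n. g d = 0) \<and>
     (\<forall>d\<ge>1. g (Suc d) \<le> g d \<and> g d \<le> Suc (g (Suc d)))"

definition profile_shape :: "(nat \<Rightarrow> nat) \<Rightarrow> (nat \<times> nat) set" where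
  "profile_shape g = {(i, j). 1 \<le> i \<and> i < j \<and> i \<le> g (j - i)}"

text \<open>The value at \<open>x\<close> is the one that \<open>{Suc (g x)..g x + x}\<close> adds
  to the interval for \<open>x - 1\<close>: a new minimum if \<open>g\<close> drops, a new maximum
  otherwise.\<close>

definition profile_perm :: "(nat \<Rightarrow> nat) \<Rightarrow> nat \<Rightarrow> nat" where
  "profile_perm g x = (if 1 < x \<and> g (x - 1) \<noteq> g x then Suc (g x) else g x + x)"

lemma diag_profile_antimono:
  assumes "diag_profile n g" "1 \<le> d" "d \<le> e"
  shows "g e \<le> g d"
  using assms(3)
proof (induction e rule: dec_induct)
  case (step e)
  then show ?case
    using assms(1,2) unfolding diag_profile_def by (meson le_trans)
qed simp

text \<open>Since \<open>g\<close> vanishes at \<open>n\<close> and loses at most one per diagonal,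
  induction runs downwards from \<open>n\<close>. For \<open>d \<le> n\<close> the bound is the
  number of staircase boxes on that diagonal.\<close>

lemma diag_profile_bound:
  assumes "diag_profile n g" "1 \<le> d"
  shows "g d \<le> n - d"
proof (cases "d \<le> n")
  case True
  then show ?thesis
  proof (induction d rule: inc_induct)
    case base
    then show ?case
      using assms(1) by (simp add: diag_profile_def)
  next
    case (step e)
    have "1 \<le> e" using assms(2) step(1) by simp
    then have "g e \<le> Suc (g (Suc e))"
      using assms(1) by (simp add: diag_profile_def)
    then show ?case using step by linarith
  qed
next
  case False
  then show ?thesis
    using assms(1) by (simp add: diag_profile_def)
qed

lemma profile_shape_subset_staircase:
  assumes "diag_profile n g"
  shows "profile_shape g \<subseteq> staircase n"
proof clarify
  fix i j assume "(i, j) \<in> profile_shape g"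
  then have "1 \<le> i" "i < j" "i \<le> g (j - i)" by (auto simp: profile_shape_def)
  moreover from this have "g (j - i) \<le> n - (j - i)"
    using diag_profile_bound[OF assms, of "j - i"] by linarith
  ultimately show "(i, j) \<in> staircase n"
    by (auto simp: staircase_def)
qed

lemma profile_shape_ideal:
  assumes "diag_profile n g" "(i, j) \<in> profile_shape g" "1 \<le> i'" "i' < j'" "i' \<le> i" "j' \<le> j"
  shows "(i', j') \<in> profile_shape g"
proof -
  from assms(2) have ij: "i < j" "i \<le> g (j - i)" by (auto simp: profile_shape_def)
  show ?thesis
  proof (cases "j' - i' \<le> j - i")
    case True
    then have "g (j - i) \<le> g (j' - i')"
      using diag_profile_antimono[OF assms(1)] assms(4) by simp
    with ij assms show ?thesis by (auto simp: profile_shape_def)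
  next
    case False
    \<comment> \<open>As \<open>j' \<le> j\<close>, the diagonal index grows by at most
      \<open>i - i'\<close>. A loss of at most one per diagonal is therefore paid for by the smaller
      row.\<close>
    have drop: "g d \<le> g (d + m) + m" if "1 \<le> d" for d m
    proof (induction m)
      case (Suc m)
      have "g (d + m) \<le> Suc (g (Suc (d + m)))"
        using assms(1) that by (simp add: diag_profile_def)
      with Suc show ?case by simp
    qed simp
    have "g (j - i) \<le> g (j - i + (j' - i' - (j - i))) + (j' - i' - (j - i))"
      using drop[of "j - i"] ij by simp
    also have "j - i + (j' - i' - (j - i)) = j' - i'"
      using False by linarith
    finally show ?thesis
      using ij False assms by (auto simp: profile_shape_def)
  qed
qed

text \<open>On each diagonal \<open>d \<ge> 1\<close> the shape shows \<open>g d\<close> as its last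
  row. This identifies a profile produced by a filling with a prescribed one.\<close>

lemma profile_shape_inject:
  assumes "diag_profile n g" "diag_profile m h" "profile_shape g = profile_shape h"
  shows "g = h"
proof
  fix d
  have "i \<le> g d \<longleftrightarrow> i \<le> h d" if "1 \<le> i" "1 \<le> d" for i
  proof -
    have "(i, i + d) \<in> profile_shape g \<longleftrightarrow> (i, i + d) \<in> profile_shape h"
      using assms(3) by simp
    with that show ?thesis by (simp add: profile_shape_def)
  qed
  then show "g d = h d"
    using assms(1,2) unfolding diag_profile_def
    by (metis le_antisym less_one linorder_not_less order_refl zero_le)
qed

section \<open>Adding one box\<close>

text \<open>The neighbours force \<open>g\<close> to be \<open>i\<close>, \<open>i - 1\<close>,
  \<open>i - 1\<close> at \<open>p - 1\<close>, \<open>p\<close>, \<open>p + 1\<close> (the first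
  only if \<open>p > 1\<close>), so the new box is the next one on its diagonal. Injectivity ensures
  that \<open>transpose i j\<close> moves no other value.\<close>

lemma profile_add_box:
  assumes g: "diag_profile n g"
    and b: "(i, j) \<in> staircase n" "(i, j) \<notin> profile_shape g"
    and left: "i < j - 1 \<Longrightarrow> (i, j - 1) \<in> profile_shape g"
    and above: "1 < i \<Longrightarrow> (i - 1, j) \<in> profile_shape g"
  defines "h \<equiv> g(j - i := i)"
  shows "diag_profile n h" "profile_shape h = insert (i, j) (profile_shape g)"
    and "inj (profile_perm g) \<Longrightarrow> profile_perm h = transpose i j \<circ> profile_perm g"
proof -
  define p where "p = j - i"
  have ij: "1 \<le> i" "i < j" "j \<le> n" using b(1) by (auto simp: staircase_def)
  then have p: "1 \<le> p" "j = i + p" "p < n" by (auto simp: p_def)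
  have gp: "g p < i" using b(2) ij by (auto simp: profile_shape_def p_def)
  have gS: "g (Suc d) \<le> g d" "g d \<le> Suc (g (Suc d))" if "1 \<le> d" for d
    using g that by (auto simp: diag_profile_def)
  \<comment> \<open>The upper neighbour is in row \<open>i - 1\<close> on diagonal
    \<open>Suc p\<close>.\<close>
  have "i - 1 \<le> g (Suc p)"
  proof (cases "1 < i")
    case True
    then have "j - (i - 1) = Suc p" using p by linarith
    with above[OF True] show ?thesis by (auto simp: profile_shape_def)
  qed simp
  with gp gS(1)[OF p(1)] ij have eq: "g p = i - 1" "g (Suc p) = i - 1" by linarith+
  \<comment> \<open>The left neighbour is in row \<open>i\<close> on diagonal \<open>p - 1\<close>;
    for \<open>p = 1\<close> it would leave the staircase.\<close>
  have prev: "g (p - 1) = i" if "1 < p"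
  proof -
    have "i < j - 1" "j - 1 - i = p - 1" using that p by linarith+
    with left have "i \<le> g (p - 1)" by (auto simp: profile_shape_def)
    moreover have "g (p - 1) \<le> Suc (g p)" using gS(2)[of "p - 1"] that by simp
    ultimately show ?thesis using eq ij by linarith
  qed
  have h: "h = g(p := i)" by (simp add: h_def p_def)
  show "diag_profile n h"
    unfolding diag_profile_def
  proof (intro conjI allI impI)
    show "h 0 = 0" using g p by (simp add: h diag_profile_def)
  next
    fix d assume "n \<le> d"
    then show "h d = 0" using g p by (simp add: h diag_profile_def)
  next
    fix d :: nat assume d: "1 \<le> d"
    consider "d = p" | "Suc d = p" | "d \<noteq> p" "Suc d \<noteq> p" by blast
    then have "h (Suc d) \<le> h d \<and> h d \<le> Suc (h (Suc d))"
    proof cases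
      case 1
      then show ?thesis using eq by (simp add: h)
    next
      case 2
      with prev d have "g d = i" by force
      with 2 show ?thesis by (auto simp: h)
    next
      case 3
      then show ?thesis using gS[OF d] by (simp add: h)
    qed
    then show "h (Suc d) \<le> h d" "h d \<le> Suc (h (Suc d))" by auto
  qed
  have "(a, c) \<in> profile_shape h \<longleftrightarrow> (a, c) \<in> insert (i, j) (profile_shape g)" for a c
  proof (cases "a < c \<and> c - a = p")
    case True
    then have "c = a + p" by linarith
    with True eq p ij show ?thesis by (auto simp: profile_shape_def h)
  next
    case False
    then show ?thesis using p by (auto simp: profile_shape_def h)
  qed
  then show "profile_shape h = insert (i, j) (profile_shape g)"
    by auto
  assume inj: "inj (profile_perm g)"
  \<comment> \<open>Raising \<open>g p\<close> to \<open>i\<close> moves the drop from before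
    \<open>p\<close> to after it, so a minimum followed by a maximum becomes a maximum followed by a
    minimum.\<close>
  have at_p: "profile_perm g p = i" "profile_perm g (Suc p) = j"
    "profile_perm h p = j" "profile_perm h (Suc p) = i"
    using prev eq p ij by (auto simp: profile_perm_def h)
  show "profile_perm h = transpose i j \<circ> profile_perm g"
  proof
    fix x
    consider "x = p" | "x = Suc p" | "x \<noteq> p" "x \<noteq> Suc p" by blast
    then show "profile_perm h x = (transpose i j \<circ> profile_perm g) x"
    proof cases
      case 3
      then have "profile_perm g x \<noteq> i" "profile_perm g x \<noteq> j"
        using injD[OF inj] at_p by metis+
      moreover have "profile_perm h x = profile_perm g x"
        using 3 by (auto simp: profile_perm_def h)
      ultimately show ?thesis by simp
    qed (use at_p in auto)
  qed
qed

section \<open>From partial fillings to left-unimodal permutations\<close>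

text \<open>Each new position extends the interval by one: at the top if \<open>g\<close> stays
  constant, at the bottom if it drops.\<close>

lemma profile_perm_image:
  assumes "diag_profile n g" "1 \<le> j"
  shows "profile_perm g ` {1..j} = {Suc (g j)..g j + j}"
  using assms(2)
proof (induction j rule: dec_induct)
  case base
  show ?case by (simp add: profile_perm_def)
next
  case (step j)
  have "g (Suc j) \<le> g j" "g j \<le> Suc (g (Suc j))"
    using assms(1) step by (auto simp: diag_profile_def)
  then consider "g (Suc j) = g j" | "g j = Suc (g (Suc j))" by linarith
  moreover have "profile_perm g ` {1..Suc j} =
      insert (profile_perm g (Suc j)) {Suc (g j)..g j + j}"
    using step.IH by (simp add: atLeastAtMostSuc_conv)
  ultimately show ?case
    using step(1) by cases (auto simp: profile_perm_def)
qed

lemma associated_perm_erase_above_Suc: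
  assumes T: "is_filling n T" and k: "Suc k \<le> n * (n - 1) div 2"
    and b: "(i, j) \<in> staircase n" "T (i, j) = Suc k"
  shows "associated_perm (erase_above n (Suc k) T) =
    transpose i j \<circ> associated_perm (erase_above n k T)"
proof -
  \<comment> \<open>The two folds look boxes up in different partial fillings, but an entry up to
    \<open>k\<close> sits in the same box of both.\<close>
  have "entry_transposition (erase_above n (Suc k) T) r = entry_transposition (erase_above n k T) r"
    if r: "1 \<le> r" "r \<le> k" for r
  proof -
    have "r \<in> T ` staircase n"
      using T k r by (simp add: is_filling_def bij_betw_def)
    then obtain c where "c \<in> staircase n" "r = T c" by blast
    with T r show ?thesis by (simp add: entry_transposition_def box_of_erase_above)
  qed
  then have "fold (\<lambda>r p. entry_transposition (erase_above n (Suc k) T) r \<circ> p) [1..<Suc k] id =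
    fold (\<lambda>r p. entry_transposition (erase_above n k T) r \<circ> p) [1..<Suc k] id"
    by (intro fold_cong) auto
  moreover have "entry_transposition (erase_above n (Suc k) T) (Suc k) = transpose i j"
    using box_of_erase_above[OF T b(1), of "Suc k"] b(2) by (simp add: entry_transposition_def)
  ultimately show ?thesis
    using k by (simp add: associated_perm_def card_dom_erase_above[OF T])
qed

text \<open>Induction on \<open>k\<close>, adding the box of entry \<open>Suc k\<close>. The
  \<open>permutes\<close> clause supplies the injectivity for the next step; the shape clause pins
  down \<open>g\<close> for the converse inclusion.\<close>

lemma partial_filling_profile:
  assumes T: "is_filling n T" and k: "k \<le> n * (n - 1) div 2"
  shows "\<exists>g. diag_profile n g \<and> profile_shape g = {b \<in> staircase n. T b \<le> k} \<and>
    profile_perm g = associated_perm (erase_above n k T) \<and> profile_perm g permutes {1..n}"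
  using k
proof (induction k)
  case 0
  have "1 \<le> T b" if "b \<in> staircase n" for b
    using T that by (auto simp: is_filling_def bij_betw_def)
  then have "profile_shape (\<lambda>_. 0) = {b \<in> staircase n. T b \<le> 0}"
    by (fastforce simp: profile_shape_def)
  moreover have "profile_perm (\<lambda>_. 0) = id"
    by (auto simp: profile_perm_def)
  moreover have "associated_perm (erase_above n 0 T) = id"
    by (simp add: associated_perm_def card_dom_erase_above[OF T])
  ultimately show ?case
    by (intro exI[of _ "\<lambda>_. 0"]) (simp add: diag_profile_def permutes_id flip: id_def)
next
  case (Suc k)
  then obtain g where g: "diag_profile n g" "profile_shape g = {b \<in> staircase n. T b \<le> k}"
    "profile_perm g = associated_perm (erase_above n k T)" "profile_perm g permutes {1..n}"
    by auto
  have "Suc k \<in> T ` staircase n"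
    using T Suc.prems by (simp add: is_filling_def bij_betw_def)
  then obtain i j where b: "(i, j) \<in> staircase n" "T (i, j) = Suc k" by force
  have inj: "inj_on T (staircase n)"
    using T by (simp add: is_filling_def bij_betw_def)
  have notin: "(i, j) \<notin> profile_shape g" using b g(2) by simp
  \<comment> \<open>Increasing rows and columns give the left and upper neighbours entries at most
    \<open>k\<close>, so they are already present.\<close>
  have left: "(i, j - 1) \<in> profile_shape g" if "i < j - 1"
  proof -
    have "(i, j - 1) \<in> staircase n" using b(1) that by (auto simp: staircase_def)
    moreover have "T (i, j - 1) < T (i, j)"
      using T b(1) calculation that unfolding is_filling_def
      by (metis diff_less zero_less_one less_trans neq0_conv not_less_zero zero_diff)
    ultimately show ?thesis using b(2) g(2) by simp
  qed
  have above: "(i - 1, j) \<in> profile_shape g" if "1 < i"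
  proof -
    have "(i - 1, j) \<in> staircase n" using b(1) that by (auto simp: staircase_def)
    moreover have "T (i - 1, j) < T (i, j)"
      using T b(1) calculation that unfolding is_filling_def
      by (metis diff_less less_trans zero_less_one)
    ultimately show ?thesis using b(2) g(2) by simp
  qed
  note add = profile_add_box[OF g(1) b(1) notin left above]
  have "insert (i, j) {b \<in> staircase n. T b \<le> k} = {b \<in> staircase n. T b \<le> Suc k}"
  proof (intro set_eqI iffI)
    fix c assume "c \<in> {b \<in> staircase n. T b \<le> Suc k}"
    then show "c \<in> insert (i, j) {b \<in> staircase n. T b \<le> k}"
      using inj_onD[OF inj, of c "(i, j)"] b by (cases "T c = Suc k") auto
  qed (use b in auto)
  moreover have perm: "profile_perm (g(j - i := i)) = transpose i j \<circ> profile_perm g"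
    using add(3) permutes_inj[OF g(4)] by blast
  moreover have "transpose i j \<circ> profile_perm g permutes {1..n}"
    using b(1) by (intro permutes_compose[OF g(4)] permutes_swap_id) (auto simp: staircase_def)
  ultimately show ?case
    using add(1,2) g(2,3) associated_perm_erase_above_Suc[OF T Suc.prems b] by metis
qed

section \<open>From left-unimodal permutations to profiles\<close>

lemma left_unimodal_profile:
  assumes "left_unimodal n p"
  obtains g where "diag_profile n g" "profile_perm g = p"
proof -
  have perm: "p permutes {1..n}" using assms by (simp add: left_unimodal_def)
  have inj: "inj p" using perm by (rule permutes_inj)
  \<comment> \<open>Here \<open>m\<close> is one less than the minimum of the image, which is at
    least 1. At \<open>j = n\<close> the image is all of \<open>{1..n}\<close>, giving the boundary
    value 0.\<close>
  have "\<exists>m. p ` {1..j} = {Suc m..m + j} \<and> (j = n \<longrightarrow> m = 0)" if j: "1 \<le> j" "j \<le> n" for j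
  proof -
    obtain a b where ab: "p ` {1..j} = {a..b}"
      using assms j unfolding left_unimodal_def by blast
    have "card {a..b} = j"
      using card_image[OF inj_on_subset[OF inj], of "{1..j}"] ab by simp
    then have len: "Suc b - a = j" by simp
    then have "a \<in> p ` {1..j}" using ab j by auto
    then have a: "1 \<le> a"
      using permutes_in_image[OF perm] j by fastforce
    then obtain m where m: "a = Suc m" by (cases a) auto
    have "m = 0" if "j = n"
    proof -
      have "{1..n} = {a..b}" using ab that permutes_image[OF perm] by metis
      moreover have "1 \<in> {1..n}" using j by simp
      ultimately have "a \<le> 1" by simp
      with m show ?thesis by simp
    qed
    moreover have "b = m + j" using len m j by linarith
    ultimately show ?thesis
      using ab m by blast
  qed
  then obtain f where f: "\<And>j. 1 \<le> j \<Longrightarrow> j \<le> n \<Longrightarrow> p ` {1..j} = {Suc (f j)..f j + j}"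
    and fn: "1 \<le> n \<Longrightarrow> f n = 0"
    by (metis order_refl)
  \<comment> \<open>The chosen \<open>f\<close> is arbitrary outside \<open>{1..n}\<close>, so
    \<open>g\<close> is set to 0 there.\<close>
  define g where "g j = (if 1 \<le> j \<and> j \<le> n then f j else 0)" for j
  have step: "g j = g (Suc j) \<and> p (Suc j) = g (Suc j) + Suc j \<or>
      g j = Suc (g (Suc j)) \<and> p (Suc j) = Suc (g (Suc j))" if j: "1 \<le> j" "Suc j \<le> n" for j
  proof -
    let ?a = "g j" and ?b = "g (Suc j)" and ?v = "p (Suc j)"
    have "p ` {1..Suc j} = insert ?v (p ` {1..j})"
      by (simp add: atLeastAtMostSuc_conv)
    with f j have ins: "{Suc ?b..?b + Suc j} = insert ?v {Suc ?a..?a + j}"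
      by (simp add: g_def)
    have "?v \<notin> p ` {1..j}"
      by (simp add: inj_image_mem_iff[OF inj])
    with f j have v: "?v \<notin> {Suc ?a..?a + j}" by (simp add: g_def)
    \<comment> \<open>Both ends of the old interval lie in the new one, which is longer by one;
      hence its lower end stays or moves down by one. The end it gains must be
      \<open>?v\<close>.\<close>
    have "Suc ?a \<in> {Suc ?b..?b + Suc j}" "?a + j \<in> {Suc ?b..?b + Suc j}"
      using ins j by auto
    then have "?a = ?b \<or> ?a = Suc ?b" by auto
    then show ?thesis
    proof
      assume a: "?a = ?b"
      have "?b + Suc j \<in> insert ?v {Suc ?a..?a + j}"
        by (simp flip: ins)
      with a show ?thesis by auto
    next
      assume a: "?a = Suc ?b"
      have "Suc ?b \<in> insert ?v {Suc ?a..?a + j}"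
        by (simp flip: ins)
      with a show ?thesis by auto
    qed
  qed
  have "diag_profile n g"
    unfolding diag_profile_def
  proof (intro conjI allI impI)
    show "g 0 = 0" by (simp add: g_def)
  next
    fix d assume "n \<le> d"
    then show "g d = 0" using fn by (auto simp: g_def)
  next
    fix d :: nat assume d: "1 \<le> d"
    have "g (Suc d) \<le> g d \<and> g d \<le> Suc (g (Suc d))"
    proof (cases "Suc d \<le> n")
      case True
      then show ?thesis using step[OF d] by auto
    next
      case False
      then show ?thesis using fn by (cases "d = n") (auto simp: g_def)
    qed
    then show "g (Suc d) \<le> g d" "g d \<le> Suc (g (Suc d))" by auto
  qed
  moreover have "profile_perm g = p"
  proof
    fix x
    consider "x = 0" | "n < x" | "x = 1" "1 \<le> n" | j where "x = Suc j" "1 \<le> j" "Suc j \<le> n"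
      by (cases x) force+
    then show "profile_perm g x = p x"
    proof cases
      case 1
      then show ?thesis
        using permutes_not_in[OF perm, of 0] by (simp add: profile_perm_def g_def)
    next
      case 2
      \<comment> \<open>At \<open>x = Suc n\<close> the preceding value is \<open>g n\<close>, which
        is 0 by \<open>fn\<close>.\<close>
      then have "g x = 0" "1 < x \<Longrightarrow> g (x - 1) = 0"
        using fn by (auto simp: g_def le_less intro: Suc_lessI)
      moreover have "p x = x" using 2 permutes_not_in[OF perm, of x] by simp
      ultimately show ?thesis by (simp add: profile_perm_def)
    next
      case 3
      then show ?thesis using f[of 1] by (simp add: profile_perm_def g_def)
    next
      case 4
      then show ?thesis using step[of j] by (auto simp: profile_perm_def)
    qed
  qed
  ultimately show ?thesis by (rule that)
qed

section \<open>Fillings that start with a given shape\<close>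

lemma finite_staircase: "finite (staircase n)"
  by (rule finite_subset[of _ "{1..n} \<times> {1..n}"]) (auto simp: staircase_def)

lemma card_staircase: "card (staircase n) = n * (n - 1) div 2"
proof (induction n)
  case 0
  have "staircase 0 = {}" by (auto simp: staircase_def)
  then show ?case by simp
next
  case (Suc n)
  have "staircase (Suc n) = staircase n \<union> (\<lambda>i. (i, Suc n)) ` {1..n}"
    by (auto simp: staircase_def)
  moreover have "card ((\<lambda>i. (i, Suc n)) ` {1..n}) = n"
    by (subst card_image) (auto simp: inj_on_def)
  moreover have "staircase n \<inter> (\<lambda>i. (i, Suc n)) ` {1..n} = {}"
    by (auto simp: staircase_def)
  ultimately have "card (staircase (Suc n)) = n * (n - 1) div 2 + n"
    using Suc by (simp add: card_Un_disjoint finite_staircase)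
  also have "\<dots> = (n * (n - 1) + n * 2) div 2" by simp
  also have "n * (n - 1) + n * 2 = Suc n * (Suc n - 1)"
    by (cases n) (auto simp: algebra_simps)
  finally show ?case .
qed

text \<open>Turns an injective key into a numbering without gaps. A larger key has a strictly larger
  down-set, so ranks are distinct; counting makes them exhaust \<open>{1..card A}\<close>.\<close>

lemma rank_bij_betw:
  fixes h :: "'a \<Rightarrow> 'b::linorder"
  assumes "finite A" "inj_on h A"
  defines "r \<equiv> \<lambda>b. card {c \<in> A. h c \<le> h b}"
  shows "bij_betw r A {1..card A}"
    and "\<And>a b. a \<in> A \<Longrightarrow> b \<in> A \<Longrightarrow> h a < h b \<Longrightarrow> r a < r b"
proof -
  show mono: "r a < r b" if "a \<in> A" "b \<in> A" "h a < h b" for a b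
  proof -
    have "{c \<in> A. h c \<le> h a} \<subset> {c \<in> A. h c \<le> h b}"
    proof
      show "{c \<in> A. h c \<le> h a} \<subseteq> {c \<in> A. h c \<le> h b}"
        using that by auto
      have "b \<in> {c \<in> A. h c \<le> h b} - {c \<in> A. h c \<le> h a}"
        using that by auto
      then show "{c \<in> A. h c \<le> h a} \<noteq> {c \<in> A. h c \<le> h b}"
        by blast
    qed
    with assms(1) show ?thesis unfolding r_def by (intro psubset_card_mono) auto
  qed
  have inj: "inj_on r A"
  proof (rule inj_onI, rule ccontr)
    fix a b assume ab: "a \<in> A" "b \<in> A" "r a = r b" "a \<noteq> b"
    then have "h a < h b \<or> h b < h a" using inj_onD[OF assms(2)] by (metis neq_iff)
    with mono ab show False by (metis less_irrefl)
  qed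
  have "r ` A \<subseteq> {1..card A}"
  proof clarify
    fix b assume "b \<in> A"
    then have "{c \<in> A. h c \<le> h b} \<noteq> {}" by blast
    with assms(1) have "0 < r b" unfolding r_def by (simp add: card_gt_0_iff)
    moreover have "r b \<le> card A" unfolding r_def using assms(1) by (intro card_mono) auto
    ultimately show "r b \<in> {1..card A}" by simp
  qed
  moreover have "card (r ` A) = card {1..card A}" using inj by (simp add: card_image)
  ultimately show "bij_betw r A {1..card A}"
    using inj card_subset_eq[of "{1..card A}" "r ` A"] by (simp add: bij_betw_def)
qed

lemma filling_with_initial_shape:
  assumes g: "diag_profile n g"
  obtains T where "is_filling n T"
    "profile_shape g = {b \<in> staircase n. T b \<le> card (profile_shape g)}"
proof -
  let ?I = "profile_shape g" and ?A = "staircase n"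
  \<comment> \<open>The base exceeds every row and column label, so \<open>fst b * M + snd b\<close>
    is a two-digit numeral and stays below the offset \<open>M * M\<close>.\<close>
  define M where "M = Suc n"
  \<comment> \<open>Boxes of the shape come first, and rows are read from left to right within each part.\<close>
  define h where "h b = (if b \<in> ?I then 0 else M * M) + fst b * M + snd b" for b
  define T where "T b = card {c \<in> ?A. h c \<le> h b}" for b
  have sub: "?I \<subseteq> ?A" using g by (rule profile_shape_subset_staircase)
  have row_less: "a * M + b < c * M" if "a < c" "b < M" for a b c
  proof -
    have "a * M + b < Suc a * M" using that by simp
    also have "\<dots> \<le> c * M" using that by (intro mult_le_mono1) simp
    finally show ?thesis .
  qed
  have key: "fst b * M + snd b < M * M" if "b \<in> ?A" for b
    using that by (intro row_less) (auto simp: staircase_def M_def)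
  have "inj_on h ?A"
  proof (rule inj_onI)
    fix b c assume bc: "b \<in> ?A" "c \<in> ?A" "h b = h c"
    then have eq: "fst b * M + snd b = fst c * M + snd c"
      using key[of b] key[of c] by (auto simp: h_def split: if_splits)
    have "snd b < M" "snd c < M" using bc by (auto simp: staircase_def M_def)
    with eq row_less[of "fst b" "fst c" "snd b"] row_less[of "fst c" "fst b" "snd c"]
    have "fst b = fst c" by (metis add.commute linorder_neqE_nat not_add_less2)
    with eq show "b = c" by (simp add: prod_eq_iff)
  qed
  note rank = rank_bij_betw[OF finite_staircase this, folded T_def]
  have mono: "T (i, j) < T (i', j')"
    if b: "(i, j) \<in> ?A" "(i', j') \<in> ?A" and le: "i \<le> i'" "j \<le> j'" "i < i' \<or> j < j'" for i j i' j'
  proof (rule rank(2)[OF b])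
    \<comment> \<open>The ideal property excludes the one bad case, a box outside the shape
      preceding a box inside it.\<close>
    have "(i, j) \<in> ?I" if "(i', j') \<in> ?I"
      using profile_shape_ideal[OF g that] b le by (auto simp: staircase_def)
    moreover have "i * M + j < i' * M + j'"
    proof (cases "i < i'")
      case True
      then show ?thesis using row_less[of i i' j] b by (auto simp: staircase_def M_def)
    next
      case False
      then show ?thesis using le by simp
    qed
    ultimately show "h (i, j) < h (i', j')" by (auto simp: h_def)
  qed
  have fin: "finite ?I" using sub finite_staircase by (rule finite_subset)
  have "is_filling n T"
    unfolding is_filling_def using rank(1) mono by (auto simp: card_staircase)
  moreover have "?I = {b \<in> ?A. T b \<le> card ?I}"
  proof (intro set_eqI iffI)
    fix b assume b: "b \<in> ?I"
    \<comment> \<open>Keys inside the shape are below \<open>M * M\<close>, those outside are not,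
      so no outside box precedes \<open>b\<close>.\<close>
    have "{c \<in> ?A. h c \<le> h b} \<subseteq> ?I"
      using b key[of b] sub by (auto simp: h_def split: if_splits)
    then have "T b \<le> card ?I" unfolding T_def by (intro card_mono fin)
    with b sub show "b \<in> {b \<in> ?A. T b \<le> card ?I}" by auto
  next
    fix b assume b: "b \<in> {b \<in> ?A. T b \<le> card ?I}"
    show "b \<in> ?I"
    proof (rule ccontr)
      assume nb: "b \<notin> ?I"
      have "h c \<le> h b" if "c \<in> ?I" for c
        using that nb key[of c] sub by (auto simp: h_def)
      \<comment> \<open>A box outside comes after the whole shape, so its rank exceeds
        \<open>card ?I\<close>.\<close>
      with b sub have "insert b ?I \<subseteq> {c \<in> ?A. h c \<le> h b}" by auto
      then have "card (insert b ?I) \<le> T b"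
        unfolding T_def by (intro card_mono) (auto simp: finite_staircase)
      with b nb fin show False by simp
    qed
  qed
  ultimately show ?thesis by (rule that)
qed

theorem theorem4p1:
  fixes n :: nat
  shows "{associated_perm P | P. is_partial_filling n P} = left_unimodal_perms n"
proof (intro equalityI subsetI)
  fix p assume "p \<in> {associated_perm P | P. is_partial_filling n P}"
  then obtain T k where "is_filling n T" "k \<le> n * (n - 1) div 2"
    "p = associated_perm (erase_above n k T)"
    by (auto simp: is_partial_filling_def)
  with partial_filling_profile obtain g where "diag_profile n g" "p = profile_perm g"
    "p permutes {1..n}"
    by metis
  then show "p \<in> left_unimodal_perms n"
    using profile_perm_image unfolding left_unimodal_perms_def left_unimodal_def by blast
next
  fix p assume "p \<in> left_unimodal_perms n"
  then obtain g where g: "diag_profile n g" "profile_perm g = p"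
    by (auto simp: left_unimodal_perms_def elim: left_unimodal_profile)
  obtain T where T: "is_filling n T"
    "profile_shape g = {b \<in> staircase n. T b \<le> card (profile_shape g)}"
    using filling_with_initial_shape[OF g(1)] .
  let ?k = "card (profile_shape g)"
  have k: "?k \<le> n * (n - 1) div 2"
    using card_mono[OF finite_staircase profile_shape_subset_staircase[OF g(1)]]
    by (simp add: card_staircase)
  \<comment> \<open>The forward direction applied to \<open>T\<close> yields a profile with the
    shape of \<open>g\<close>, hence \<open>g\<close> itself.\<close>
  from partial_filling_profile[OF T(1) k] obtain h where
    "diag_profile n h" "profile_shape h = profile_shape g"
    "profile_perm h = associated_perm (erase_above n ?k T)"
    using T(2) by auto
  with g have "p = associated_perm (erase_above n ?k T)"
    using profile_shape_inject by metis
  with T(1) k show "p \<in> {associated_perm P | P. is_partial_filling n P}"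
    by (auto simp: is_partial_filling_def)
qed

end
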